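(* Let $M\in\mathbb N_0$ and define, for $u(-),u(+)\in\mathbb R^{M+1}$ and $k=0,\dots,M$, $$ \big[f^{\mathrm{num}}_{\mathrm{ec}}(u(-),u(+))\big]_k=\frac12\sum_{i,j=0}^M \mathrm E[\phi_i\phi_j\phi_k]\Big(\frac13\,\overline{u_iu_j}+\frac23\,\overline{u_i}\cdot\overline{u_j}\Big). $$ Then: (1) $f^{\mathrm{num}}_{\mathrm{ec}}$ is an entropy conservative numerical flux for the polynomial chaos system $\partial_t u+\partial_x f(u)=0$ with respect to the entropy $U=\frac12|u|^2$, i.e. $[\![u]\!]\cdot f^{\mathrm{num}}_{\mathrm{ec}}=[\![\psi]\!]$ for all $u(-),u(+)\in\mathbb R^{M+1}$. (2) If $Q$ is a positive semi-definite $(M+1)\times(M+1)$ matrix (possibly depending on $u(-),u(+)$), then $f^{\mathrm{num}}=f^{\mathrm{num}}_{\mathrm{ec}}-\frac12Q[\![u]\!]$ is entropy stable, i.e. $[\![u]\!]\cdot f^{\mathrm{num}}\le[\![\psi]\!]$ for all $u(-),u(+)\in\mathbb R^{M+1}$.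
   Context: $\phi_0\equiv1,\phi_1,\phi_2,\dots$ are the normalised probabilistic Hermite polynomials: polynomials with $\deg\phi_i=i$, orthonormal in $L^2(\mathbb R,\varrho\,dy)$ with $\varrho(y)=\frac1{\sqrt{2\pi}}e^{-y^2/2}$; $\mathrm E[\phi_i\phi_j\phi_k]=\int_{\mathbb R}\phi_i\phi_j\phi_k\,\varrho\,dy$, which is symmetric in $i,j,k$. The polynomial chaos system of order $M$ for Burgers' equation is $\partial_t u+\partial_x f(u)=0$ for $u=(u_0,\dots,u_M)^T$, with $f(u)=\frac12A(u)u$ and $[A(u)]_{jk}=\sum_{i=0}^M\mathrm E[\phi_i\phi_j\phi_k]u_i$. The flux potential associated with $U=\frac12|u|^2$ is $\psi(u)=\frac16u^TA(u)u=\frac16\sum_{i,j,k=0}^M\mathrm E[\phi_i\phi_j\phi_k]u_iu_ju_k$. For two states $u(-),u(+)\in\mathbb R^{M+1}$ and a quantity $a$ depending on $u$, write $a(\pm)$ for its value at $u(\pm)$, $\overline a=\frac12(a(+)+a(-))$ for the mean value and $[\![a]\!]=a(+)-a(-)$ for the jump; in particular $\overline{u_iu_j}=\frac12(u_i(+)u_j(+)+u_i(-)u_j(-))$ and $[\![\psi]\!]=\psi(u(+))-\psi(u(-))$. *)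

theory Defs
  imports "HOL-Probability.Distributions" "Jordan_Normal_Form.Matrix"
begin

no_notation inner (infix "\<bullet>" 70)
no_notation vec_nth (infixl "$" 90)

text \<open>The library's \<open>std_normal_density\<close> is \<open>\<lambda>y. 1 / sqrt (2 * pi) * exp (- y\<^sup>2 / 2)\<close>. The conditions
  below determine the normalised probabilistic Hermite polynomials up to the sign of each
  \<open>\<phi> i\<close> with \<open>i > 0\<close>.\<close>

definition hermite_system :: "(nat \<Rightarrow> real poly) \<Rightarrow> bool" where
  "hermite_system \<phi> \<longleftrightarrow>
     \<phi> 0 = 1 \<and>
     (\<forall>i. degree (\<phi> i) = i) \<and>
     (\<forall>i j. (LINT y|lborel. poly (\<phi> i) y * poly (\<phi> j) y * std_normal_density y)
        = (if i = j then 1 else 0))"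

definition triple_expectation :: "(nat \<Rightarrow> real poly) \<Rightarrow> nat \<Rightarrow> nat \<Rightarrow> nat \<Rightarrow> real" where
  "triple_expectation \<phi> i j k =
     (LINT y|lborel. poly (\<phi> i) y * poly (\<phi> j) y * poly (\<phi> k) y * std_normal_density y)"

text \<open>States are elements of \<open>carrier_vec (M + 1)\<close>, with components indexed by \<open>0, \<dots>, M\<close>.\<close>

definition pc_matrix :: "(nat \<Rightarrow> real poly) \<Rightarrow> nat \<Rightarrow> real vec \<Rightarrow> real mat" where
  "pc_matrix \<phi> M u =
     mat (M + 1) (M + 1) (\<lambda>(j, k). \<Sum>i=0..M. triple_expectation \<phi> i j k * u $ i)"

definition flux_potential :: "(nat \<Rightarrow> real poly) \<Rightarrow> nat \<Rightarrow> real vec \<Rightarrow> real" where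
  "flux_potential \<phi> M u = 1 / 6 * (u \<bullet> (pc_matrix \<phi> M u *\<^sub>v u))"

text \<open>In everything that follows the first state is \<open>u(-)\<close> and the second one is \<open>u(+)\<close>.\<close>

definition mean :: "('s \<Rightarrow> real) \<Rightarrow> 's \<Rightarrow> 's \<Rightarrow> real" where
  "mean a um up = 1 / 2 * (a up + a um)"

definition jump :: "('s \<Rightarrow> 'b::minus) \<Rightarrow> 's \<Rightarrow> 's \<Rightarrow> 'b" where
  "jump a um up = a up - a um"

definition ec_flux :: "(nat \<Rightarrow> real poly) \<Rightarrow> nat \<Rightarrow> real vec \<Rightarrow> real vec \<Rightarrow> real vec" where
  "ec_flux \<phi> M um up = vec (M + 1) (\<lambda>k.
     1 / 2 * (\<Sum>i=0..M. \<Sum>j=0..M. triple_expectation \<phi> i j k *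
       (1 / 3 * mean (\<lambda>u. u $ i * u $ j) um up
        + 2 / 3 * (mean (\<lambda>u. u $ i) um up * mean (\<lambda>u. u $ j) um up))))"

definition entropy_conservative ::
    "nat \<Rightarrow> (real vec \<Rightarrow> real) \<Rightarrow> (real vec \<Rightarrow> real vec \<Rightarrow> real vec) \<Rightarrow> bool" where
  "entropy_conservative n \<psi> g \<longleftrightarrow>
     (\<forall>um \<in> carrier_vec n. \<forall>up \<in> carrier_vec n. jump (\<lambda>u. u) um up \<bullet> g um up = jump \<psi> um up)"

definition entropy_stable ::
    "nat \<Rightarrow> (real vec \<Rightarrow> real) \<Rightarrow> (real vec \<Rightarrow> real vec \<Rightarrow> real vec) \<Rightarrow> bool" where
  "entropy_stable n \<psi> g \<longleftrightarrow>
     (\<forall>um \<in> carrier_vec n. \<forall>up \<in> carrier_vec n. jump (\<lambda>u. u) um up \<bullet> g um up \<le> jump \<psi> um up)"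

text \<open>Symmetry is not required, so this covers both conventions for positive semi-definiteness.\<close>

definition pos_semidefinite :: "nat \<Rightarrow> real mat \<Rightarrow> bool" where
  "pos_semidefinite n Q \<longleftrightarrow> Q \<in> carrier_mat n n \<and> (\<forall>v \<in> carrier_vec n. 0 \<le> v \<bullet> (Q *\<^sub>v v))"

end

theory Submission
  imports Defs
begin

text \<open>Everything takes place in the trilinear form \<open>S(x, y, z) = \<Sum>ijk. E[\<phi>\<^sub>i \<phi>\<^sub>j \<phi>\<^sub>k] x\<^sub>i y\<^sub>j z\<^sub>k\<close>. A
  product of three polynomials does not depend on the order of its factors, and so \<open>S\<close> is symmetric.
  The flux potential is \<open>\<psi>(u) = S(u, u, u) / 6\<close>. Write \<open>a = u(+)\<close>,
  \<open>b = u(-)\<close> and \<open>d = a - b\<close>. The weights \<open>1/3\<close> and \<open>2/3\<close> in the flux are those that turn its product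
  with the jump into
  \<open>(S(a,a,d) + S(b,b,d) + S(a+b,a+b,d)) / 12 = (S(a,a,d) + S(a,b,d) + S(b,b,d)) / 6\<close>. Since \<open>S\<close> is
  symmetric, this telescopes exactly like \<open>(a\<^sup>2 + a b + b\<^sup>2) (a - b) = a\<^sup>3 - b\<^sup>3\<close>, and the result is the
  jump of \<open>\<psi>\<close>.

  A term \<open>- Q d / 2\<close> adds \<open>- d \<bullet> Q d / 2 \<le> 0\<close> to this product. This gives entropy stability.\<close>

definition trilinear_form ::
    "nat \<Rightarrow> (nat \<Rightarrow> nat \<Rightarrow> nat \<Rightarrow> real) \<Rightarrow> (nat \<Rightarrow> real) \<Rightarrow> (nat \<Rightarrow> real) \<Rightarrow> (nat \<Rightarrow> real) \<Rightarrow> real" where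
  "trilinear_form M T x y z = (\<Sum>i=0..M. \<Sum>j=0..M. \<Sum>k=0..M. T i j k * x i * y j * z k)"

lemma trilinear_form_add:
  "trilinear_form M T (\<lambda>i. x i + x' i) y z = trilinear_form M T x y z + trilinear_form M T x' y z"
  "trilinear_form M T x (\<lambda>i. y i + y' i) z = trilinear_form M T x y z + trilinear_form M T x y' z"
  "trilinear_form M T x y (\<lambda>i. z i + z' i) = trilinear_form M T x y z + trilinear_form M T x y z'"
  by (simp_all add: trilinear_form_def algebra_simps sum.distrib)

lemma trilinear_form_diff:
  "trilinear_form M T x y (\<lambda>i. z i - z' i) = trilinear_form M T x y z - trilinear_form M T x y z'"
  by (simp add: trilinear_form_def algebra_simps sum_subtractf)

lemma trilinear_form_swap_first:
  assumes "\<And>i j k. T i j k = T j i k"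
  shows "trilinear_form M T x y z = trilinear_form M T y x z"
proof -
  have "trilinear_form M T x y z = (\<Sum>j=0..M. \<Sum>i=0..M. \<Sum>k=0..M. T i j k * x i * y j * z k)"
    unfolding trilinear_form_def by (rule sum.swap)
  also have "\<dots> = trilinear_form M T y x z"
    unfolding trilinear_form_def
    by (intro sum.cong refl) (subst assms, simp)
  finally show ?thesis .
qed

lemma trilinear_form_swap_last:
  assumes "\<And>i j k. T i j k = T i k j"
  shows "trilinear_form M T x y z = trilinear_form M T x z y"
proof -
  have "trilinear_form M T x y z = (\<Sum>i=0..M. \<Sum>k=0..M. \<Sum>j=0..M. T i j k * x i * y j * z k)"
    unfolding trilinear_form_def by (intro sum.cong refl sum.swap)
  also have "\<dots> = trilinear_form M T x z y"
    unfolding trilinear_form_def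
    by (intro sum.cong refl) (subst assms, simp)
  finally show ?thesis .
qed

text \<open>The polarised form of \<open>(a\<^sup>2 + b\<^sup>2 + (a + b)\<^sup>2) (a - b) = 2 (a\<^sup>3 - b\<^sup>3)\<close>: in a symmetric trilinear
  form the arguments multiply like commuting variables.\<close>

lemma symmetric_trilinear_form_cube_diff:
  fixes M :: nat
  assumes first: "\<And>i j k. T i j k = T j i k" and last: "\<And>i j k. T i j k = T i k j"
  defines "S \<equiv> trilinear_form M T"
  shows "S a a (\<lambda>i. a i - b i) + S b b (\<lambda>i. a i - b i)
      + S (\<lambda>i. a i + b i) (\<lambda>i. a i + b i) (\<lambda>i. a i - b i)
    = 2 * (S a a a - S b b b)"
proof -
  have "S a b a = S a a b" "S b a a = S a a b" "S b a b = S a b b" "S b b a = S a b b"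
    unfolding S_def
    using trilinear_form_swap_first[of T, OF first] trilinear_form_swap_last[of T, OF last]
    by metis+
  then show ?thesis
    unfolding S_def by (simp add: trilinear_form_add trilinear_form_diff)
qed

lemma triple_expectation_symmetric:
  "triple_expectation \<phi> i j k = triple_expectation \<phi> j i k"
  "triple_expectation \<phi> i j k = triple_expectation \<phi> i k j"
  by (simp_all add: triple_expectation_def mult_ac)

lemma flux_potential_trilinear:
  assumes "u \<in> carrier_vec (M + 1)"
  shows "flux_potential \<phi> M u
    = 1 / 6 * trilinear_form M (triple_expectation \<phi>) (($) u) (($) u) (($) u)"
proof -
  have "u \<bullet> (pc_matrix \<phi> M u *\<^sub>v u)
      = (\<Sum>j=0..M. u $ j * (\<Sum>k=0..M. (\<Sum>i=0..M. triple_expectation \<phi> i j k * u $ i) * u $ k))"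
    using assms
    by (simp add: pc_matrix_def scalar_prod_def atLeastLessThanSuc_atLeastAtMost
        del: sum.cl_ivl_Suc sum.op_ivl_Suc)
  also have "\<dots> = (\<Sum>j=0..M. \<Sum>k=0..M. \<Sum>i=0..M. triple_expectation \<phi> i j k * u $ i * u $ j * u $ k)"
    by (simp add: sum_distrib_left sum_distrib_right mult_ac)
  also have "\<dots> = (\<Sum>j=0..M. \<Sum>i=0..M. \<Sum>k=0..M. triple_expectation \<phi> i j k * u $ i * u $ j * u $ k)"
    by (intro sum.cong refl sum.swap)
  also have "\<dots> = trilinear_form M (triple_expectation \<phi>) (($) u) (($) u) (($) u)"
    unfolding trilinear_form_def by (rule sum.swap)
  finally show ?thesis by (simp add: flux_potential_def)
qed

text \<open>The average of the products contributes the weight \<open>1/2 * 1/3 * 1/2 = 1/12\<close>, and the product of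
  the averages contributes \<open>1/2 * 2/3 * 1/4 = 1/12\<close>. With these equal weights the preceding cube
  identity applies.\<close>

lemma jump_scalar_prod_ec_flux:
  fixes \<phi> :: "nat \<Rightarrow> real poly" and M :: nat
  assumes um: "um \<in> carrier_vec (M + 1)" and up: "up \<in> carrier_vec (M + 1)"
  defines "S \<equiv> trilinear_form M (triple_expectation \<phi>)" and "d \<equiv> \<lambda>i. up $ i - um $ i"
  shows "(up - um) \<bullet> ec_flux \<phi> M um up
    = 1 / 12 * (S (($) up) (($) up) d + S (($) um) (($) um) d
        + S (\<lambda>i. up $ i + um $ i) (\<lambda>i. up $ i + um $ i) d)"
proof -
  let ?w = "\<lambda>i j. 1 / 3 * mean (\<lambda>u. u $ i * u $ j) um up
        + 2 / 3 * (mean (\<lambda>u. u $ i) um up * mean (\<lambda>u. u $ j) um up)"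
  have w: "1 / 2 * ?w i j = 1 / 12 * (up $ i * up $ j + um $ i * um $ j
      + (up $ i + um $ i) * (up $ j + um $ j))" for i j
    by (simp add: mean_def field_simps)
  have "(up - um) \<bullet> ec_flux \<phi> M um up
      = (\<Sum>k=0..M. d k * (1 / 2 * (\<Sum>i=0..M. \<Sum>j=0..M. triple_expectation \<phi> i j k * ?w i j)))"
    using um up
    by (simp add: ec_flux_def scalar_prod_def d_def atLeastLessThanSuc_atLeastAtMost
        del: sum.cl_ivl_Suc sum.op_ivl_Suc)
  also have "\<dots> = (\<Sum>k=0..M. \<Sum>i=0..M. \<Sum>j=0..M. triple_expectation \<phi> i j k * d k * (1 / 2 * ?w i j))"
    by (simp add: sum_distrib_left mult_ac)
  also have "\<dots> = (\<Sum>i=0..M. \<Sum>k=0..M. \<Sum>j=0..M. triple_expectation \<phi> i j k * d k * (1 / 2 * ?w i j))"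
    by (rule sum.swap)
  also have "\<dots> = (\<Sum>i=0..M. \<Sum>j=0..M. \<Sum>k=0..M. triple_expectation \<phi> i j k * d k * (1 / 2 * ?w i j))"
    by (intro sum.cong refl sum.swap)
  also have "\<dots> = (\<Sum>i=0..M. \<Sum>j=0..M. \<Sum>k=0..M. 1 / 12 *
      (triple_expectation \<phi> i j k * up $ i * up $ j * d k
       + triple_expectation \<phi> i j k * um $ i * um $ j * d k
       + triple_expectation \<phi> i j k * (up $ i + um $ i) * (up $ j + um $ j) * d k))"
    unfolding w by (intro sum.cong refl) (simp add: algebra_simps)
  also have "\<dots> = 1 / 12 * (S (($) up) (($) up) d + S (($) um) (($) um) d
        + S (\<lambda>i. up $ i + um $ i) (\<lambda>i. up $ i + um $ i) d)"
    unfolding S_def trilinear_form_def sum_distrib_left[symmetric] sum.distrib by (rule refl)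
  finally show ?thesis .
qed

lemma entropy_conservative_ec_flux:
  "entropy_conservative (M + 1) (flux_potential \<phi> M) (ec_flux \<phi> M)"
  unfolding entropy_conservative_def jump_def
proof (intro ballI)
  fix um up :: "real vec"
  assume "um \<in> carrier_vec (M + 1)" "up \<in> carrier_vec (M + 1)"
  then show "(up - um) \<bullet> ec_flux \<phi> M um up = flux_potential \<phi> M up - flux_potential \<phi> M um"
    using symmetric_trilinear_form_cube_diff[of "triple_expectation \<phi>" M "($) up" "($) um",
        OF triple_expectation_symmetric]
    by (simp add: jump_scalar_prod_ec_flux flux_potential_trilinear)
qed

text \<open>The dissipation term changes the product with the jump by minus half the quadratic form of \<open>Q\<close>,
  whatever the conservative flux is. The carrier condition on \<open>g\<close> makes the scalar product distribute
  over the difference: differences and scalar products both take their dimension from the second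
  operand.\<close>

lemma entropy_stable_dissipation:
  assumes cons: "entropy_conservative n \<psi> g"
    and g: "\<And>um up. um \<in> carrier_vec n \<Longrightarrow> up \<in> carrier_vec n \<Longrightarrow> g um up \<in> carrier_vec n"
    and Q: "\<And>um up. um \<in> carrier_vec n \<Longrightarrow> up \<in> carrier_vec n \<Longrightarrow> pos_semidefinite n (Q um up)"
  shows "entropy_stable n \<psi> (\<lambda>um up. g um up - (1 / 2) \<cdot>\<^sub>v (Q um up *\<^sub>v jump (\<lambda>u. u) um up))"
  unfolding entropy_stable_def
proof (intro ballI)
  fix um up :: "real vec"
  assume um: "um \<in> carrier_vec n" and up: "up \<in> carrier_vec n"
  define d where "d = jump (\<lambda>u. u) um up"
  have d: "d \<in> carrier_vec n"
    using um up by (simp add: d_def jump_def)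
  have Qd: "Q um up *\<^sub>v d \<in> carrier_vec n" and pos: "0 \<le> d \<bullet> (Q um up *\<^sub>v d)"
    using Q[OF um up] d by (auto simp: pos_semidefinite_def)
  have "d \<bullet> (g um up - (1 / 2) \<cdot>\<^sub>v (Q um up *\<^sub>v d)) = d \<bullet> g um up - 1 / 2 * (d \<bullet> (Q um up *\<^sub>v d))"
    using d Qd g[OF um up] by (simp add: scalar_prod_minus_distrib)
  also have "\<dots> \<le> d \<bullet> g um up"
    using pos by simp
  also have "\<dots> = jump \<psi> um up"
    using cons um up by (simp add: entropy_conservative_def d_def)
  finally show "jump (\<lambda>u. u) um up \<bullet> (g um up - (1 / 2) \<cdot>\<^sub>v (Q um up *\<^sub>v jump (\<lambda>u. u) um up))
      \<le> jump \<psi> um up"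
    by (simp add: d_def)
qed

theorem mainTheorem2:
  fixes \<phi> :: "nat \<Rightarrow> real poly" and M :: nat
  assumes "hermite_system \<phi>"
  shows "entropy_conservative (M + 1) (flux_potential \<phi> M) (ec_flux \<phi> M) \<and>
    (\<forall>Q :: real vec \<Rightarrow> real vec \<Rightarrow> real mat.
       (\<forall>um \<in> carrier_vec (M + 1). \<forall>up \<in> carrier_vec (M + 1). pos_semidefinite (M + 1) (Q um up)) \<longrightarrow>
       entropy_stable (M + 1) (flux_potential \<phi> M)
         (\<lambda>um up. ec_flux \<phi> M um up - (1 / 2) \<cdot>\<^sub>v (Q um up *\<^sub>v jump (\<lambda>u. u) um up)))"
proof (intro conjI allI impI)
  show "entropy_conservative (M + 1) (flux_potential \<phi> M) (ec_flux \<phi> M)"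
    by (rule entropy_conservative_ec_flux)
next
  fix Q :: "real vec \<Rightarrow> real vec \<Rightarrow> real mat"
  assume "\<forall>um \<in> carrier_vec (M + 1). \<forall>up \<in> carrier_vec (M + 1). pos_semidefinite (M + 1) (Q um up)"
  then show "entropy_stable (M + 1) (flux_potential \<phi> M)
         (\<lambda>um up. ec_flux \<phi> M um up - (1 / 2) \<cdot>\<^sub>v (Q um up *\<^sub>v jump (\<lambda>u. u) um up))"
    by (intro entropy_stable_dissipation entropy_conservative_ec_flux) (auto simp: ec_flux_def)
qed

end
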